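(* Let $p>2$ be a prime, let $\rho$ be a complex irreducible representation of $GL(2,\mathbb{F}_p)$ of dimension $d(\rho)$, and let $A$ be a non-zero matrix in $M(2,\mathbb{F}_p)$. Then $$|\mathrm{Tr}(G(\rho,A))|\leq d(\rho)\,p^{2}.$$
   Context: $e_p(z)=e^{2\pi i z/p}$. For a representation $\rho$ of $GL(2,\mathbb{F}_p)$ and $A\in M(2,\mathbb{F}_p)$, $G(\rho,A)=\sum_{X\in GL(2,\mathbb{F}_p)}\rho(X)\,e_p(\mathrm{Tr}(AX))$. *)

theory Defs
  imports "HOL-Analysis.Analysis" "Berlekamp_Zassenhaus.Finite_Field"
begin

text \<open>
  The field with \<open>p\<close> elements is \<^typ>\<open>'p::prime_card mod_ring\<close>, where \<open>p = CARD('p)\<close>; the class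
  \<^class>\<open>prime_card\<close> says exactly that \<open>CARD('p)\<close> is prime.
\<close>

definition GL2 :: "('p::prime_card mod_ring ^ 2 ^ 2) set" where
  "GL2 = {X. invertible X}"

text \<open>
  The additive character is evaluated at the representative in \<open>{0..<p}\<close>; by periodicity any integer
  representative gives the same value, see \<open>e_p_of_int\<close> below.
\<close>

definition e_p :: "'p::prime_card mod_ring \<Rightarrow> complex" where
  "e_p z = exp (2 * of_real pi * \<i> * of_int (to_int_mod_ring z) / of_nat CARD('p))"

lemma e_p_of_int:
  "e_p (of_int k :: 'p::prime_card mod_ring) = exp (2 * of_real pi * \<i> * of_int k / of_nat CARD('p))"
proof -
  let ?p = "int CARD('p)"
  have r: "to_int_mod_ring (of_int k :: 'p mod_ring) = k mod ?p"
    unfolding of_int_of_int_mod_ring by transfer simp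
  have "(of_int k :: complex) = of_int (k mod ?p + ?p * (k div ?p))"
    by simp
  then have k: "(of_int k :: complex) = of_int (k mod ?p) + of_nat CARD('p) * of_int (k div ?p)"
    by (simp only: of_int_add of_int_mult of_int_of_nat_eq)
  have "2 * of_real pi * \<i> * of_int k / of_nat CARD('p)
      = 2 * of_real pi * \<i> * of_int (k mod ?p) / of_nat CARD('p)
        + 2 * of_int (k div ?p) * of_real pi * \<i>"
    unfolding k by (simp add: field_simps)
  moreover have "exp (2 * of_int (k div ?p) * of_real pi * \<i>) = 1"
    by (auto simp: exp_eq_1)
  ultimately show ?thesis
    unfolding e_p_def r by (simp add: exp_add)
qed

text \<open>
  A complex representation of dimension \<open>CARD('d)\<close>, in matrix form. The values of \<open>\<rho>\<close> outside
  \<^const>\<open>GL2\<close> are irrelevant; on it they are invertible, being images of group elements under a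
  homomorphism of monoids.
\<close>

definition is_representation ::
  "('p::prime_card mod_ring ^ 2 ^ 2 \<Rightarrow> complex ^ 'd ^ 'd) \<Rightarrow> bool" where
  "is_representation \<rho> \<longleftrightarrow>
     \<rho> (mat 1) = mat 1 \<and> (\<forall>X\<in>GL2. \<forall>Y\<in>GL2. \<rho> (X ** Y) = \<rho> X ** \<rho> Y)"

text \<open>
  \<open>vec.subspace\<close> is the notion of a linear subspace over the complex scalars (as opposed to
  \<^const>\<open>subspace\<close>, which is over the reals). The space \<^typ>\<open>complex ^ 'd\<close> is never zero.
\<close>

definition is_irreducible_representation ::
  "('p::prime_card mod_ring ^ 2 ^ 2 \<Rightarrow> complex ^ 'd ^ 'd) \<Rightarrow> bool" where
  "is_irreducible_representation \<rho> \<longleftrightarrow>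
     is_representation \<rho> \<and>
     (\<forall>W. vec.subspace W \<and> (\<forall>X\<in>GL2. \<forall>w\<in>W. \<rho> X *v w \<in> W) \<longrightarrow> W = {0} \<or> W = UNIV)"

definition gauss_sum ::
  "('p::prime_card mod_ring ^ 2 ^ 2 \<Rightarrow> complex ^ 'd ^ 'd) \<Rightarrow> 'p mod_ring ^ 2 ^ 2 \<Rightarrow> complex ^ 'd ^ 'd"
  where
  "gauss_sum \<rho> A = (\<Sum>X\<in>GL2. map_matrix (\<lambda>c. c * e_p (trace (A ** X))) (\<rho> X))"

end

theory Submission
  imports Defs
begin

text \<open>
  If \<open>A\<close> is invertible, then \<open>\<rho>(B) G(\<rho>, A) = G(\<rho>, A B\<^sup>-\<^sup>1)\<close>, so in the averaged
  invariant norm \<open>N\<close> the Plancherel formula on \<open>M(2, F\<^sub>p)\<close> gives \<open>N(G(\<rho>, A) v) \<le> p\<^sup>2 N(v)\<close>, which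
  bounds the trace.

  If \<open>A\<close> has rank one, conjugate it so that its rows are \<open>(\<alpha>, \<beta>)\<close> and \<open>0\<close>. Conjugation by
  upper triangular matrices moves \<open>\<beta>\<close>, and averaging over \<open>\<beta>\<close> reduces the trace to the sum
  \<open>\<Sum> \<rho>(X) e\<^sub>p(\<alpha> x\<^sub>1\<^sub>1)\<close> over the Borel subgroup. Its image lies in the space of vectors fixed by the
  mirabolic subgroup \<open>x\<^sub>1\<^sub>1 = 1, x\<^sub>2\<^sub>1 = 0\<close>, so its trace is at most \<open>p (p - 1)\<^sup>2 r\<close>, where \<open>r\<close> is
  the dimension of that space. Finally \<open>(p - 1) r \<le> d(\<rho>)\<close> unless \<open>\<rho>\<close> is trivial: each of
  the \<open>p - 1\<close> nontrivial isotypic projections of the opposite unipotent group is injective on the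
  mirabolic-fixed vectors, because a torus that fixes these vectors permutes the projections, and a
  vector killed by all of them is fixed by all of \<open>GL\<^sub>2\<close>.
\<close>

section \<open>Traces and Hermitian forms\<close>

text \<open>One shape for three operators: Gauss sums, sums over the Borel subgroup and isotypic
  projections. Scaling entrywise through \<open>map_matrix\<close> copies the form of
  \<open>gauss_sum\<close>.\<close>

definition weighted_sum :: "('i \<Rightarrow> complex ^ 'd ^ 'd) \<Rightarrow> 'i set \<Rightarrow> ('i \<Rightarrow> complex) \<Rightarrow> complex ^ 'd ^ 'd" where
  "weighted_sum R S f = (\<Sum>i\<in>S. map_matrix (\<lambda>c. c * f i) (R i))"

lemma gauss_sum_eq_weighted_sum:
  "gauss_sum \<rho> A = weighted_sum \<rho> GL2 (\<lambda>X. e_p (trace (A ** X)))"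
  by (simp add: gauss_sum_def weighted_sum_def)

lemma weighted_sum_mult_vec:
  "weighted_sum R S f *v v = (\<Sum>i\<in>S. f i *s (R i *v v))"
proof -
  have "weighted_sum R S f *v v = (\<Sum>i\<in>S. map_matrix (\<lambda>c. c * f i) (R i) *v v)"
    unfolding weighted_sum_def
    by (induction S rule: infinite_finite_induct)
      (simp_all add: matrix_vector_mult_add_rdistrib)
  also have "\<dots> = (\<Sum>i\<in>S. f i *s (R i *v v))"
    by (intro sum.cong refl)
      (simp add: vec_eq_iff matrix_vector_mult_def map_matrix_def sum_distrib_left ac_simps)
  finally show ?thesis .
qed

lemma trace_weighted_sum:
  "trace (weighted_sum R S f) = (\<Sum>i\<in>S. f i * trace (R i))"
proof -
  have "trace (weighted_sum R S f) = (\<Sum>i\<in>S. trace (map_matrix (\<lambda>c. c * f i) (R i)))"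
    unfolding weighted_sum_def
    by (induction S rule: infinite_finite_induct)
      (simp_all add: trace_add trace_0[unfolded mat_0])
  also have "\<dots> = (\<Sum>i\<in>S. f i * trace (R i))"
    by (intro sum.cong refl)
      (simp add: trace_def map_matrix_def sum_distrib_left ac_simps)
  finally show ?thesis .
qed

text \<open>\<open>M\<close> is a sum of rank-one operators sending \<open>v\<close> to
  \<open>\<phi> b v *s b\<close>, each of trace \<open>\<phi> b b\<close>. This lets a trace be
  computed from a basis of any subspace that contains the range.\<close>

lemma trace_eq_sum_coordinates:
  fixes M :: "'a::field ^ 'n ^ 'n"
  assumes "finite B"
    and expand: "\<And>v. M *v v = (\<Sum>b\<in>B. \<phi> b v *s b)"
    and add: "\<And>b u v. \<phi> b (u + v) = \<phi> b u + \<phi> b v"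
    and scale: "\<And>b c v. \<phi> b (c *s v) = c * \<phi> b v"
  shows "trace M = (\<Sum>b\<in>B. \<phi> b b)"
proof -
  have zero: "\<phi> b 0 = 0" for b
    using scale[of b 0 0] by simp
  have sum: "\<phi> b (\<Sum>i\<in>I. u i) = (\<Sum>i\<in>I. \<phi> b (u i))" if "finite I" for b u and I :: "'n set"
    using that by induction (simp_all add: zero add)
  have diag: "M $ i $ i = (\<Sum>b\<in>B. b $ i * \<phi> b (axis i 1))" for i
  proof -
    have "M $ i $ i = (M *v axis i 1) $ i"
      by (simp add: matrix_vector_mult_def axis_def if_distrib[of "times _"] cong: if_cong)
    also have "\<dots> = (\<Sum>b\<in>B. b $ i * \<phi> b (axis i 1))"
      by (simp add: expand sum_component ac_simps)
    finally show ?thesis .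
  qed
  have "trace M = (\<Sum>b\<in>B. \<Sum>i\<in>UNIV. \<phi> b (b $ i *s axis i 1))"
    unfolding trace_def diag scale by (rule sum.swap)
  also have "\<dots> = (\<Sum>b\<in>B. \<phi> b b)"
    by (simp add: sum[symmetric] basis_expansion)
  finally show ?thesis .
qed

text \<open>In a basis of the range, every basis vector is fixed by \<open>E\<close> and so
  contributes 1.\<close>

lemma trace_idempotent_eq_dim_range:
  fixes E :: "complex ^ 'd ^ 'd"
  assumes idem: "\<And>v. E *v (E *v v) = E *v v"
  shows "trace E = of_nat (vec.dim (range ((*v) E)))"
proof -
  let ?W = "range ((*v) E)"
  obtain B where B: "B \<subseteq> ?W" "vec.independent B" "?W \<subseteq> vec.span B" "card B = vec.dim ?W"
    using vec.basis_exists by blast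
  have fin: "finite B"
    using B(2) vec.finiteI_independent by blast
  have span: "E *v v \<in> vec.span B" for v
    using B(3) by blast
  have "trace E = (\<Sum>b\<in>B. vec.representation B (E *v b) b)"
  proof (rule trace_eq_sum_coordinates[OF fin, where \<phi> = "\<lambda>b v. vec.representation B (E *v v) b"])
    show "E *v v = (\<Sum>b\<in>B. vec.representation B (E *v v) b *s b)" for v
      using vec.sum_representation_eq[OF B(2) span fin order_refl] by simp
  qed (simp_all add: matrix_vector_right_distrib vec.representation_add[OF B(2) span span]
        vec.representation_scale[OF B(2) span] vec.scale)
  also have "\<dots> = (\<Sum>b\<in>B. 1)"
  proof (intro sum.cong refl)
    fix b assume b: "b \<in> B"
    then have "E *v b = b"
      using B(1) idem by auto
    then show "vec.representation B (E *v b) b = 1"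
      using vec.representation_basis[OF B(2) b] by simp
  qed
  finally show ?thesis
    using B(4) by simp
qed

section \<open>Complex inner products and orthonormal bases\<close>

locale hermitian_form =
  fixes h :: "complex ^ 'd \<Rightarrow> complex ^ 'd \<Rightarrow> complex"
  assumes add_left: "h (u + u') v = h u v + h u' v"
    and scale_left: "h (c *s u) v = c * h u v"
    and cnj_swap: "h v u = cnj (h u v)"
    and pos: "v \<noteq> 0 \<Longrightarrow> 0 < Re (h v v)"
begin

lemma zero_left [simp]: "h 0 v = 0"
  using scale_left[of 0 0 v] by simp

lemma diff_left: "h (u - u') v = h u v - h u' v"
  using add_left[of "u - u'" u' v] by simp

lemma sum_left: "h (\<Sum>i\<in>I. u i) v = (\<Sum>i\<in>I. h (u i) v)"
  by (induction I rule: infinite_finite_induct) (simp_all add: add_left)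

lemma scale_right: "h u (c *s v) = cnj c * h u v"
  by (metis cnj_swap complex_cnj_mult scale_left)

lemma diff_right: "h u (v - v') = h u v - h u v'"
  by (metis cnj_swap complex_cnj_diff diff_left)

lemma real_diag: "h v v = of_real (Re (h v v))"
  using cnj_swap[of v v] by (simp add: complex_eq_iff)

lemma nonneg: "0 \<le> Re (h v v)"
  using pos[of v] by (cases "v = 0") auto

text \<open>Subtracting from \<open>u\<close> its projection to \<open>b\<close> leaves a vector
  whose squared norm, \<open>h u u\<close> minus the squared modulus of \<open>h u b\<close>, is
  nonnegative.\<close>

lemma Cauchy_Schwarz_unit:
  assumes "h b b = 1"
  shows "(cmod (h u b))\<^sup>2 \<le> Re (h u u)"
proof -
  let ?z = "h u b"
  have "h (u - ?z *s b) (u - ?z *s b) = h u u - ?z * cnj ?z"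
    using assms cnj_swap[of b u]
    by (simp add: diff_left diff_right scale_left scale_right algebra_simps)
  also have "?z * cnj ?z = of_real ((cmod ?z)\<^sup>2)"
    by (rule complex_norm_square[symmetric])
  finally show ?thesis
    using nonneg[of "u - ?z *s b"] by simp
qed

definition orthonormal :: "(complex ^ 'd) set \<Rightarrow> bool" where
  "orthonormal B \<longleftrightarrow> (\<forall>b\<in>B. \<forall>b'\<in>B. h b b' = (if b = b' then 1 else 0))"

lemma orthonormal_expansion:
  assumes "finite B" "orthonormal B" "v \<in> vec.span B"
  shows "v = (\<Sum>b\<in>B. h v b *s b)"
  using assms(3)
proof (induction rule: vec.span_induct_alt)
  case base
  show ?case by simp
next
  case (step c x y)
  have "(\<Sum>b\<in>B. h x b *s b) = (\<Sum>b\<in>B. if b = x then b else 0)"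
    using assms(2) step(1) by (intro sum.cong refl) (auto simp: orthonormal_def)
  also have "\<dots> = x"
    using assms(1) step(1) by simp
  finally have x: "(\<Sum>b\<in>B. h x b *s b) = x" .
  have "(\<Sum>b\<in>B. h (c *s x + y) b *s b) = c *s (\<Sum>b\<in>B. h x b *s b) + (\<Sum>b\<in>B. h y b *s b)"
    by (simp add: add_left scale_left vec.scale_left_distrib sum.distrib vec.scale_sum_right)
  then show ?case
    using x step(2) by simp
qed

lemma orthonormal_independent:
  assumes "finite B" "orthonormal B"
  shows "vec.independent B"
proof
  assume "vec.dependent B"
  then obtain x where x: "x \<in> B" "x \<in> vec.span (B - {x})"
    unfolding vec.dependent_def by blast
  have "orthonormal (B - {x})"
    using assms(2) by (auto simp: orthonormal_def)
  then have "x = (\<Sum>b\<in>B - {x}. h x b *s b)"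
    using x(2) assms(1) by (intro orthonormal_expansion) auto
  also have "\<dots> = 0"
    using assms(2) x(1) by (intro sum.neutral) (auto simp: orthonormal_def)
  finally have "x = 0" .
  moreover have "h x x = 1"
    using assms(2) x(1) by (simp add: orthonormal_def)
  ultimately show False
    by simp
qed

text \<open>Gram-Schmidt: subtract from \<open>x\<close> its projection to the span of
  \<open>B\<close>, then discard the remainder \<open>y\<close> if it is zero and normalise it
  otherwise.\<close>

lemma orthonormal_spanning_set:
  assumes "finite S"
  shows "\<exists>B. finite B \<and> orthonormal B \<and> vec.span B = vec.span S"
  using assms
proof induction
  case empty
  show ?case
    by (intro exI[of _ "{}"]) (auto simp: orthonormal_def)
next
  case (insert x S)
  then obtain B where B: "finite B" "orthonormal B" "vec.span B = vec.span S"
    by blast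
  define y where "y = x - (\<Sum>b\<in>B. h x b *s b)"
  have proj: "(\<Sum>b\<in>B. h x b *s b) \<in> vec.span B"
    by (intro vec.span_sum vec.span_scale vec.span_base)
  have span_x: "vec.span (insert x S) = vec.span (insert x B)"
    unfolding vec.span_insert B(3) ..
  show ?case
  proof (cases "y = 0")
    case True
    then have "x \<in> vec.span B"
      using proj by (simp add: y_def)
    then show ?thesis
      using B span_x by (metis vec.span_redundant)
  next
    case False
    define r where "r = Re (h y y)"
    have r: "r > 0"
      using pos[OF False] by (simp add: r_def)
    \<comment> \<open>The factor that gives \<open>c *s y\<close> norm 1.\<close>
    define c :: complex where "c = of_real (1 / sqrt r)"
    have c: "c \<noteq> 0" "c * cnj c * of_real r = 1"
      using r by (simp_all add: c_def flip: of_real_mult)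
    have hyb: "h y b = 0" if "b \<in> B" for b
    proof -
      have "h (\<Sum>b\<in>B. h x b *s b) b = (\<Sum>b'\<in>B. if b' = b then h x b' else 0)"
        unfolding sum_left scale_left
        using B(2) that by (intro sum.cong refl) (auto simp: orthonormal_def)
      then show ?thesis
        using that B(1) by (simp add: y_def diff_left)
    qed
    have hby: "h b y = 0" if "b \<in> B" for b
      using hyb[OF that] cnj_swap[of b y] by simp
    have unit: "h (c *s y) (c *s y) = 1"
      using c(2) real_diag[of y] by (simp add: scale_left scale_right r_def ac_simps)
    have "c *s y \<notin> B"
      using hyb[of "c *s y"] unit by (auto simp: scale_left)
    then have on: "orthonormal (insert (c *s y) B)"
      using B(2) hyb hby unit by (auto simp: orthonormal_def scale_left scale_right)
    have "vec.span (insert (c *s y) B) = vec.span (insert x B)"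
    proof (rule vec.span_eq[THEN iffD2], intro conjI)
      have "c *s y \<in> vec.span (insert x B)"
        unfolding y_def
        by (intro vec.span_scale vec.span_diff vec.span_sum vec.span_base) auto
      then show "insert (c *s y) B \<subseteq> vec.span (insert x B)"
        by (auto intro: vec.span_base)
      have "x = inverse c *s (c *s y) + (\<Sum>b\<in>B. h x b *s b)"
        using c(1) by (simp add: y_def)
      moreover have "\<dots> \<in> vec.span (insert (c *s y) B)"
        by (intro vec.span_add vec.span_scale vec.span_sum vec.span_base) auto
      ultimately show "insert x B \<subseteq> vec.span (insert (c *s y) B)"
        by (auto intro: vec.span_base)
    qed
    then show ?thesis
      using on B(1) span_x by (metis finite_insert)
  qed
qed

text \<open>An orthonormal basis of \<open>W\<close> suffices to compute the trace, so the bound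
  counts \<open>vec.dim W\<close> diagonal entries rather than all of them. This gain is what the
  rank one case relies on.\<close>

lemma cmod_trace_le:
  assumes W: "vec.subspace W" "range ((*v) M) \<subseteq> W"
    and bound: "\<And>b. h b b = 1 \<Longrightarrow> cmod (h (M *v b) b) \<le> c"
  shows "cmod (trace M) \<le> c * vec.dim W"
proof -
  obtain S where S: "S \<subseteq> W" "vec.independent S" "W \<subseteq> vec.span S" "card S = vec.dim W"
    using vec.basis_exists by blast
  have "vec.span S = W"
    using S W(1) by (simp add: vec.span_minimal subset_antisym)
  moreover have "finite S"
    using S(2) vec.finiteI_independent by blast
  ultimately obtain B where B: "finite B" "orthonormal B" "vec.span B = W"
    using orthonormal_spanning_set by metis
  have card: "card B = vec.dim W"
    using vec.dim_span_eq_card_independent[OF orthonormal_independent[OF B(1,2)]] B(3) by simp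
  have "trace M = (\<Sum>b\<in>B. h (M *v b) b)"
  proof (rule trace_eq_sum_coordinates[OF B(1), where \<phi> = "\<lambda>b v. h (M *v v) b"])
    show "M *v v = (\<Sum>b\<in>B. h (M *v v) b *s b)" for v
      using W(2) B by (intro orthonormal_expansion) auto
  qed (simp_all add: matrix_vector_right_distrib add_left scale_left vec.scale)
  then have "cmod (trace M) \<le> (\<Sum>b\<in>B. cmod (h (M *v b) b))"
    by (simp add: norm_sum)
  also have "\<dots> \<le> (\<Sum>b\<in>B. c)"
    using B(2) by (intro sum_mono bound) (auto simp: orthonormal_def)
  finally show ?thesis
    using card by (simp add: mult.commute)
qed

end

section \<open>The additive character and \<open>GL\<^sub>2\<close>\<close>

text \<open>Both arguments are lifted to integers, where the exponential is additive;
  \<open>e_p_of_int\<close> absorbs the reduction modulo the prime.\<close>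

lemma e_p_add: "e_p (x + y) = e_p x * e_p (y :: 'p::prime_card mod_ring)"
proof -
  define k l where "k = to_int_mod_ring x" and "l = to_int_mod_ring y"
  have "x = of_int k" "y = of_int l"
    by (simp_all add: k_def l_def of_int_of_int_mod_ring)
  moreover have "e_p (of_int k + of_int l :: 'p mod_ring) = e_p (of_int k :: 'p mod_ring) * e_p (of_int l :: 'p mod_ring)"
    unfolding of_int_add[symmetric] e_p_of_int
    by (simp add: exp_add[symmetric] distrib_left add_divide_distrib)
  ultimately show ?thesis
    by simp
qed

lemma e_p_0 [simp]: "e_p 0 = 1"
  using e_p_of_int[of 0] by simp

lemma cmod_e_p [simp]: "cmod (e_p x) = 1"
proof -
  have "2 * of_real pi * \<i> * of_int (to_int_mod_ring x) / of_nat CARD('a)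
      = \<i> * of_real (2 * pi * of_int (to_int_mod_ring x) / real CARD('a))"
    by simp
  then show ?thesis
    unfolding e_p_def by (simp only: norm_exp_i_times)
qed

lemma e_p_uminus: "e_p (- x) = cnj (e_p x)"
proof -
  have "e_p (- x) * e_p x = 1"
    using e_p_add[of "- x" x] by simp
  moreover have "cnj (e_p x) * e_p x = 1"
    using complex_norm_square[of "e_p x"] by (simp add: mult.commute)
  moreover have "e_p x \<noteq> 0"
    using cmod_e_p[of x] by force
  ultimately show ?thesis
    by (metis mult_right_cancel)
qed

lemma e_p_diff: "e_p (x - y) = e_p x * cnj (e_p y)"
  using e_p_add[of x "- y"] by (simp add: e_p_uminus)

text \<open>Otherwise the reciprocal of the prime would be an integer. All orthogonality relations
  below rest on this.\<close>

lemma e_p_1_neq_1: "e_p (1 :: 'p::prime_card mod_ring) \<noteq> 1"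
proof
  assume "e_p (1 :: 'p mod_ring) = 1"
  then have "exp (2 * of_real pi * \<i> / of_nat CARD('p)) = (1 :: complex)"
    using e_p_of_int[of 1, where 'p = 'p] by simp
  then obtain n :: int where "2 * pi / real CARD('p) = 2 * of_int n * pi"
    by (auto simp: exp_eq_1)
  then have "1 = real_of_int (n * int CARD('p))"
    by (simp add: field_simps)
  then have "n * int CARD('p) = 1"
    by linarith
  then have "CARD('p) = 1"
    by (auto simp: zmult_eq_1_iff)
  then show False
    using prime_card[where 'a = 'p] by simp
qed

text \<open>Translating the summation variable by \<open>a\<close> multiplies the sum by
  \<open>\<psi> a\<close>, which is not 1.\<close>

lemma sum_nontrivial_character:
  fixes \<psi> :: "'a::{finite, ab_group_add} \<Rightarrow> complex"
  assumes "\<And>x y. \<psi> (x + y) = \<psi> x * \<psi> y" and "\<psi> a \<noteq> 1"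
  shows "(\<Sum>x\<in>UNIV. \<psi> x) = 0"
proof -
  have "(\<Sum>x\<in>UNIV. \<psi> x) = (\<Sum>x\<in>UNIV. \<psi> (a + x))"
    by (rule sum.reindex_bij_witness[of _ "\<lambda>x. a + x" "\<lambda>x. x - a"]) auto
  also have "\<dots> = \<psi> a * (\<Sum>x\<in>UNIV. \<psi> x)"
    by (simp add: assms(1) sum_distrib_left)
  finally show ?thesis
    using assms(2) by (simp add: algebra_simps)
qed

lemma sum_e_p_mult:
  fixes a :: "'p::prime_card mod_ring"
  shows "(\<Sum>x\<in>UNIV. e_p (a * x)) = (if a = 0 then of_nat CARD('p) else 0)"
proof (cases "a = 0")
  case False
  have "(\<Sum>x\<in>UNIV. e_p (a * x)) = 0"
    using e_p_1_neq_1 False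
    by (intro sum_nontrivial_character[where a = "inverse a"]) (simp_all add: distrib_left e_p_add)
  then show ?thesis
    using False by simp
qed simp

section \<open>Fourier analysis on two by two matrices\<close>

lemma trace_mult_add_left: "trace ((A + B) ** C) = trace (A ** C) + trace (B ** C)"
  by (simp add: trace_def matrix_matrix_mult_def distrib_right sum.distrib)

lemma trace_mult_diff_right: "trace (A ** (B - C)) = trace (A ** B) - trace (A ** C)"
  for A B C :: "'a::ring_1 ^ 'n ^ 'n"
  by (simp add: trace_def matrix_matrix_mult_def right_diff_distrib sum_subtractf)

text \<open>The trace pairing is nondegenerate, so a nonzero \<open>Z\<close> defines a nontrivial
  additive character of the matrix space.\<close>

lemma sum_e_p_trace:
  fixes Z :: "'p::prime_card mod_ring ^ 2 ^ 2"
  shows "(\<Sum>A\<in>UNIV. e_p (trace (A ** Z))) = (if Z = 0 then of_nat CARD('p) ^ 4 else 0)"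
proof (cases "Z = 0")
  case True
  then show ?thesis
    by (simp add: trace_def flip: power_mult)
next
  case False
  then obtain i j where ij: "Z $ i $ j \<noteq> 0"
    by (auto simp: vec_eq_iff)
  \<comment> \<open>A scaled matrix unit that picks out the nonzero entry of \<open>Z\<close>, so
    that \<open>trace (A0 ** Z)\<close> is 1.\<close>
  define A0 :: "'p mod_ring ^ 2 ^ 2"
    where "A0 = (\<chi> k l. if k = j \<and> l = i then inverse (Z $ i $ j) else 0)"
  have "trace (A0 ** Z) = (\<Sum>k\<in>UNIV. \<Sum>l\<in>UNIV. if k = j \<and> l = i then 1 else 0)"
    unfolding trace_def matrix_matrix_mult_def A0_def
    using ij by (auto intro!: sum.cong)
  also have "\<dots> = (\<Sum>k\<in>UNIV. if k = j then 1 else 0)"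
    by (intro sum.cong refl) auto
  also have "\<dots> = 1"
    by simp
  finally have "trace (A0 ** Z) = 1" .
  then have "(\<Sum>A\<in>UNIV. e_p (trace (A ** Z))) = 0"
    using e_p_1_neq_1
    by (intro sum_nontrivial_character[where a = A0])
      (simp_all add: trace_mult_add_left e_p_add)
  then show ?thesis
    using False by simp
qed

text \<open>Expand the square and sum over \<open>A\<close> first: \<open>sum_e_p_trace\<close>
  keeps only the diagonal terms, each with the number of matrices as a factor.\<close>

lemma plancherel:
  fixes f :: "'p::prime_card mod_ring ^ 2 ^ 2 \<Rightarrow> complex"
  shows "(\<Sum>A\<in>UNIV. (cmod (\<Sum>X\<in>UNIV. f X * e_p (trace (A ** X))))\<^sup>2)
    = real CARD('p) ^ 4 * (\<Sum>X\<in>UNIV. (cmod (f X))\<^sup>2)"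
proof -
  let ?q = "of_nat CARD('p) ^ 4 :: complex"
  have twist: "e_p (trace (A ** X)) * cnj (e_p (trace (A ** Y))) = e_p (trace (A ** (X - Y)))"
    for A X Y :: "'p mod_ring ^ 2 ^ 2"
    by (simp add: trace_mult_diff_right e_p_diff)
  have "(\<Sum>A\<in>UNIV. of_real ((cmod (\<Sum>X\<in>UNIV. f X * e_p (trace (A ** X))))\<^sup>2))
     = (\<Sum>A\<in>UNIV. \<Sum>X\<in>UNIV. \<Sum>Y\<in>UNIV. f X * cnj (f Y) * e_p (trace (A ** (X - Y))))"
    unfolding complex_norm_square cnj_sum sum_product twist[symmetric]
    by (simp add: ac_simps)
  also have "\<dots> = (\<Sum>X\<in>UNIV. \<Sum>Y\<in>UNIV. \<Sum>A\<in>UNIV. f X * cnj (f Y) * e_p (trace (A ** (X - Y))))"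
    by (subst sum.swap, rule sum.cong[OF refl], rule sum.swap)
  also have "\<dots> = (\<Sum>X\<in>UNIV. \<Sum>Y\<in>UNIV. if Y = X then f X * cnj (f X) * ?q else 0)"
    unfolding sum_distrib_left[symmetric] sum_e_p_trace by (intro sum.cong refl) auto
  also have "\<dots> = of_real (real CARD('p) ^ 4 * (\<Sum>X\<in>UNIV. (cmod (f X))\<^sup>2))"
    unfolding of_real_mult of_real_sum complex_norm_square
    by (simp add: sum_distrib_left ac_simps)
  finally show ?thesis
    unfolding of_real_sum[symmetric] of_real_eq_iff .
qed

section \<open>Two by two matrices and the group \<open>GL2\<close>\<close>

definition mat2 :: "'a::zero \<Rightarrow> 'a \<Rightarrow> 'a \<Rightarrow> 'a \<Rightarrow> 'a ^ 2 ^ 2" where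
  "mat2 a b c d = vector [vector [a, b], vector [c, d]]"

lemma mat2_nth [simp]:
  "mat2 a b c d $ 1 $ 1 = a" "mat2 a b c d $ 1 $ 2 = b"
  "mat2 a b c d $ 2 $ 1 = c" "mat2 a b c d $ 2 $ 2 = d"
  by (simp_all add: mat2_def)

lemma mat2_eq_iff:
  "X = Y \<longleftrightarrow> X $ 1 $ 1 = Y $ 1 $ 1 \<and> X $ 1 $ 2 = Y $ 1 $ 2 \<and> X $ 2 $ 1 = Y $ 2 $ 1 \<and> X $ 2 $ 2 = Y $ 2 $ 2"
  for X Y :: "'a ^ 2 ^ 2"
  by (auto simp: vec_eq_iff forall_2)

lemma mat2_mult_nth:
  "(X ** Y) $ i $ j = X $ i $ 1 * Y $ 1 $ j + X $ i $ 2 * Y $ 2 $ j"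
  for X Y :: "'a::semiring_1 ^ 2 ^ 2"
  by (simp add: matrix_matrix_mult_def sum_2)

lemma mat2_mult:
  "mat2 a b c d ** mat2 a' b' c' d'
    = mat2 (a * a' + b * c') (a * b' + b * d') (c * a' + d * c') (c * b' + d * d')"
  by (simp add: mat2_eq_iff mat2_mult_nth)

lemma mat_1_eq_mat2: "mat 1 = mat2 1 0 0 1"
  by (simp add: mat2_eq_iff mat_def)

lemma in_GL2_iff: "X \<in> GL2 \<longleftrightarrow> X $ 1 $ 1 * X $ 2 $ 2 - X $ 1 $ 2 * X $ 2 $ 1 \<noteq> 0"
  by (simp add: GL2_def invertible_det_nz det_2)

lemma mat_1_in_GL2 [simp]: "mat 1 \<in> GL2"
  by (simp add: in_GL2_iff mat_def)

lemma GL2_mult [intro]: "X \<in> GL2 \<Longrightarrow> Y \<in> GL2 \<Longrightarrow> X ** Y \<in> GL2"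
  by (simp add: GL2_def invertible_mult)

lemma GL2_inverse:
  assumes "X \<in> GL2"
  obtains Y where "Y \<in> GL2" "X ** Y = mat 1" "Y ** X = mat 1"
  using assms unfolding GL2_def invertible_def by auto

lemma bij_betw_GL2_mult_left:
  assumes "Y \<in> GL2"
  shows "bij_betw (\<lambda>X. Y ** X) GL2 GL2"
proof -
  obtain Z where Z: "Z \<in> GL2" "Y ** Z = mat 1" "Z ** Y = mat 1"
    using assms by (rule GL2_inverse)
  show ?thesis
    by (rule bij_betw_byWitness[where f' = "\<lambda>X. Z ** X"])
      (use assms Z in \<open>auto simp: matrix_mul_assoc\<close>)
qed

lemma bij_betw_GL2_mult_right:
  assumes "Y \<in> GL2"
  shows "bij_betw (\<lambda>X. X ** Y) GL2 GL2"
proof -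
  obtain Z where Z: "Z \<in> GL2" "Y ** Z = mat 1" "Z ** Y = mat 1"
    using assms by (rule GL2_inverse)
  show ?thesis
    by (rule bij_betw_byWitness[where f' = "\<lambda>X. X ** Z"])
      (use assms Z in \<open>auto simp: matrix_mul_assoc[symmetric]\<close>)
qed

section \<open>The Borel subgroup\<close>

definition borel_GL2 :: "('p::prime_card mod_ring ^ 2 ^ 2) set" where
  "borel_GL2 = {X \<in> GL2. X $ 2 $ 1 = 0}"

lemma sum_borel:
  "(\<Sum>X\<in>borel_GL2. f X) = (\<Sum>a\<in>-{0}. \<Sum>b\<in>UNIV. \<Sum>d\<in>-{0}. f (mat2 a b 0 d))"
proof -
  have "(\<Sum>X\<in>borel_GL2. f X) = (\<Sum>(a, b, d)\<in>(-{0}) \<times> UNIV \<times> (-{0}). f (mat2 a b 0 d))"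
    by (rule sum.reindex_bij_witness[of _ "\<lambda>(a, b, d). mat2 a b 0 d" "\<lambda>X. (X $ 1 $ 1, X $ 1 $ 2, X $ 2 $ 2)"])
      (auto simp: borel_GL2_def in_GL2_iff mat2_eq_iff intro!: arg_cong[where f = f])
  also have "\<dots> = (\<Sum>a\<in>-{0}. \<Sum>b\<in>UNIV. \<Sum>d\<in>-{0}. f (mat2 a b 0 d))"
    by (simp add: sum.cartesian_product)
  finally show ?thesis .
qed

lemma card_mod_ring_nonzero:
  "real (card (-{0 :: 'p::prime_card mod_ring})) = real CARD('p) - 1"
  by (simp add: Compl_eq_Diff_UNIV card_Diff_singleton Suc_leI)

lemma card_borel:
  "real (card (borel_GL2 :: ('p::prime_card mod_ring ^ 2 ^ 2) set)) = real CARD('p) * (real CARD('p) - 1)\<^sup>2"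
proof -
  have "real (card (borel_GL2 :: ('p mod_ring ^ 2 ^ 2) set)) = (\<Sum>X\<in>(borel_GL2 :: ('p mod_ring ^ 2 ^ 2) set). 1)"
    by simp
  also have "\<dots> = real CARD('p) * (real CARD('p) - 1)\<^sup>2"
    unfolding sum_borel by (simp add: card_mod_ring_nonzero power2_eq_square)
  finally show ?thesis .
qed

section \<open>Representations of \<open>GL\<^sub>2\<close>\<close>

locale GL2_representation =
  fixes \<rho> :: "'p::prime_card mod_ring ^ 2 ^ 2 \<Rightarrow> complex ^ 'd ^ 'd"
  assumes representation: "is_representation \<rho>"
begin

lemma rep_one [simp]: "\<rho> (mat 1) = mat 1"
  using representation by (simp add: is_representation_def)

lemma rep_mult: "X \<in> GL2 \<Longrightarrow> Y \<in> GL2 \<Longrightarrow> \<rho> (X ** Y) = \<rho> X ** \<rho> Y"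
  using representation by (simp add: is_representation_def)

lemma rep_rep_vec: "X \<in> GL2 \<Longrightarrow> Y \<in> GL2 \<Longrightarrow> \<rho> X *v (\<rho> Y *v v) = \<rho> (X ** Y) *v v"
  by (simp add: rep_mult matrix_vector_mul_assoc)

text \<open>The unitary trick: the standard inner product summed over the group. It is not divided
  by the group order, so that \<open>Re (form v v)\<close> is just a sum of squared moduli of
  entries.\<close>

definition form :: "complex ^ 'd \<Rightarrow> complex ^ 'd \<Rightarrow> complex" where
  "form u v = (\<Sum>X\<in>GL2. \<Sum>i\<in>UNIV. (\<rho> X *v u) $ i * cnj ((\<rho> X *v v) $ i))"

lemma Re_form: "Re (form v v) = (\<Sum>X\<in>GL2. \<Sum>i\<in>UNIV. (cmod ((\<rho> X *v v) $ i))\<^sup>2)"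
  by (simp add: form_def flip: complex_norm_square)

sublocale hermitian_form form
proof
  fix u u' v :: "complex ^ 'd" and c :: complex
  show "form (u + u') v = form u v + form u' v"
    by (simp add: form_def matrix_vector_right_distrib distrib_right sum.distrib)
  show "form (c *s u) v = c * form u v"
    by (simp add: form_def vec.scale sum_distrib_left ac_simps)
  show "form v u = cnj (form u v)"
    by (simp add: form_def mult.commute)
  assume "v \<noteq> 0"
  then obtain i where "v $ i \<noteq> 0"
    by (auto simp: vec_eq_iff)
  then have "0 < (\<Sum>i\<in>UNIV. (cmod ((\<rho> (mat 1) *v v) $ i))\<^sup>2)"
    by (intro sum_pos2[of _ i]) auto
  also have "\<dots> \<le> Re (form v v)"
    unfolding Re_form by (rule member_le_sum) (auto intro: sum_nonneg)
  finally show "0 < Re (form v v)" .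
qed

text \<open>Right multiplication by \<open>Y\<close> permutes the terms of the sum over the
  group.\<close>

lemma form_invariant:
  assumes "Y \<in> GL2"
  shows "form (\<rho> Y *v u) (\<rho> Y *v v) = form u v"
proof -
  have "form (\<rho> Y *v u) (\<rho> Y *v v)
    = (\<Sum>X\<in>GL2. \<Sum>i\<in>UNIV. (\<rho> (X ** Y) *v u) $ i * cnj ((\<rho> (X ** Y) *v v) $ i))"
    unfolding form_def using assms by (intro sum.cong refl) (simp add: rep_rep_vec)
  also have "\<dots> = form u v"
    unfolding form_def by (rule sum.reindex_bij_betw[OF bij_betw_GL2_mult_right[OF assms]])
  finally show ?thesis .
qed

lemma cmod_form_rep_le:
  assumes "form b b = 1" "X \<in> GL2"
  shows "cmod (form (\<rho> X *v b) b) \<le> 1"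
proof -
  have "(cmod (form (\<rho> X *v b) b))\<^sup>2 \<le> Re (form (\<rho> X *v b) (\<rho> X *v b))"
    by (rule Cauchy_Schwarz_unit[OF assms(1)])
  then show ?thesis
    using assms by (simp add: form_invariant abs_square_le_1)
qed

text \<open>Each diagonal entry is a sum of \<open>card S\<close> weighted matrix coefficients of
  operators preserving \<open>form\<close>, each of modulus at most 1.\<close>

lemma cmod_trace_weighted_sum_le:
  assumes "S \<subseteq> GL2" "\<And>X. X \<in> S \<Longrightarrow> cmod (f X) \<le> 1"
    and W: "vec.subspace W" "\<And>v. weighted_sum \<rho> S f *v v \<in> W"
  shows "cmod (trace (weighted_sum \<rho> S f)) \<le> real (card S) * vec.dim W"
proof (rule cmod_trace_le[OF W(1)])
  show "range ((*v) (weighted_sum \<rho> S f)) \<subseteq> W"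
    using W(2) by auto
  fix b assume b: "form b b = 1"
  have "cmod (form (weighted_sum \<rho> S f *v b) b) \<le> (\<Sum>X\<in>S. cmod (f X * form (\<rho> X *v b) b))"
    unfolding weighted_sum_mult_vec sum_left scale_left by (rule norm_sum)
  also have "\<dots> \<le> (\<Sum>X\<in>S. 1)"
    using assms(1,2) cmod_form_rep_le[OF b]
    by (intro sum_mono) (auto simp: norm_mult intro!: mult_le_one)
  finally show "cmod (form (weighted_sum \<rho> S f *v b) b) \<le> real (card S)"
    by simp
qed

section \<open>The Gauss sum of an invertible matrix\<close>

lemma rep_gauss_sum:
  assumes "B \<in> GL2" "C \<in> GL2" "B ** C = mat 1"
  shows "\<rho> B *v (gauss_sum \<rho> A *v v) = gauss_sum \<rho> (A ** C) *v v"
proof -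
  have "\<rho> B *v (gauss_sum \<rho> A *v v) = (\<Sum>X\<in>GL2. e_p (trace (A ** X)) *s (\<rho> (B ** X) *v v))"
    unfolding gauss_sum_eq_weighted_sum weighted_sum_mult_vec vec.sum vec.scale
    using assms(1) by (intro sum.cong refl) (simp add: rep_rep_vec)
  \<comment> \<open>Substituting \<open>C ** X\<close> for \<open>X\<close> cancels \<open>B\<close>
    and moves \<open>C\<close> into the trace.\<close>
  also have "\<dots> = (\<Sum>X\<in>GL2. e_p (trace (A ** (C ** X))) *s (\<rho> (B ** (C ** X)) *v v))"
    by (rule sum.reindex_bij_betw[OF bij_betw_GL2_mult_left[OF assms(2)], symmetric])
  also have "\<dots> = gauss_sum \<rho> (A ** C) *v v"
    unfolding gauss_sum_eq_weighted_sum weighted_sum_mult_vec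
    by (simp add: matrix_mul_assoc assms(3))
  finally show ?thesis .
qed

text \<open>Each coordinate of \<open>gauss_sum \<rho> C *v v\<close> is, as a function of
  \<open>C\<close>, the Fourier transform of that coordinate of \<open>\<rho> X *v v\<close>
  extended by zero outside \<open>GL2\<close>. Apply \<open>plancherel\<close> coordinate by
  coordinate.\<close>

lemma sum_norm_gauss_sum:
  "(\<Sum>C\<in>UNIV. \<Sum>i\<in>UNIV. (cmod ((gauss_sum \<rho> C *v v) $ i))\<^sup>2) = real CARD('p) ^ 4 * Re (form v v)"
proof -
  define f where "f i X = (if X \<in> GL2 then (\<rho> X *v v) $ i else 0)" for i and X :: "'p mod_ring ^ 2 ^ 2"
  have gauss: "(gauss_sum \<rho> C *v v) $ i = (\<Sum>X\<in>UNIV. f i X * e_p (trace (C ** X)))" for C i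
    unfolding gauss_sum_eq_weighted_sum weighted_sum_mult_vec sum_component f_def
    by (rule sum.mono_neutral_cong_left) auto
  have "(\<Sum>X\<in>UNIV. (cmod (f i X))\<^sup>2) = (\<Sum>X\<in>GL2. (cmod ((\<rho> X *v v) $ i))\<^sup>2)" for i
    unfolding f_def by (rule sum.mono_neutral_cong_right) auto
  then show ?thesis
    unfolding gauss Re_form
    by (subst (1 2) sum.swap) (simp add: plancherel sum_distrib_left)
qed

text \<open>The invariant norm of \<open>gauss_sum \<rho> A *v v\<close> is a sum over the matrices
  \<open>A ** J B\<close>, where \<open>J\<close> chooses inverses. These are pairwise distinct
  because \<open>A\<close> is invertible, so the sum is part of the Plancherel sum over all
  matrices.\<close>

lemma cmod_trace_gauss_sum_invertible:
  assumes "A \<in> GL2"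
  shows "cmod (trace (gauss_sum \<rho> A)) \<le> real CARD('d) * real CARD('p) ^ 2"
proof -
  have "\<exists>J. \<forall>B\<in>GL2. J B \<in> GL2 \<and> B ** J B = mat 1 \<and> J B ** B = (mat 1 :: 'p mod_ring ^ 2 ^ 2)"
    using GL2_inverse by metis
  then obtain J where J: "\<And>B. B \<in> GL2 \<Longrightarrow> J B \<in> GL2 \<and> B ** J B = mat 1 \<and> J B ** B = (mat 1 :: 'p mod_ring ^ 2 ^ 2)"
    by blast
  have inj: "inj_on (\<lambda>B. A ** J B) GL2"
  proof (rule inj_onI)
    fix B C :: "'p mod_ring ^ 2 ^ 2"
    assume BC: "B \<in> GL2" "C \<in> GL2" "A ** J B = A ** J C"
    then have "J B = J C"
      using bij_betw_GL2_mult_left[OF assms] J by (meson bij_betw_imp_inj_on inj_onD)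
    then have "B ** (J B ** C) = B"
      using J[OF BC(2)] by simp
    then show "B = C"
      using J[OF BC(1)] by (simp add: matrix_mul_assoc)
  qed
  have bound: "Re (form (gauss_sum \<rho> A *v v) (gauss_sum \<rho> A *v v)) \<le> real CARD('p) ^ 4 * Re (form v v)" for v
  proof -
    let ?g = "\<lambda>C. \<Sum>i\<in>UNIV. (cmod ((gauss_sum \<rho> C *v v) $ i))\<^sup>2"
    have "Re (form (gauss_sum \<rho> A *v v) (gauss_sum \<rho> A *v v)) = (\<Sum>B\<in>GL2. ?g (A ** J B))"
      unfolding Re_form
    proof (rule sum.cong[OF refl])
      fix B :: "'p mod_ring ^ 2 ^ 2" assume "B \<in> GL2"
      then have "\<rho> B *v (gauss_sum \<rho> A *v v) = gauss_sum \<rho> (A ** J B) *v v"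
        using J by (intro rep_gauss_sum) auto
      then show "(\<Sum>i\<in>UNIV. (cmod ((\<rho> B *v (gauss_sum \<rho> A *v v)) $ i))\<^sup>2) = ?g (A ** J B)"
        by simp
    qed
    also have "\<dots> = sum ?g ((\<lambda>B. A ** J B) ` GL2)"
      by (simp add: sum.reindex[OF inj])
    also have "\<dots> \<le> sum ?g UNIV"
      by (rule sum_mono2) (auto intro: sum_nonneg)
    finally show ?thesis
      by (simp add: sum_norm_gauss_sum)
  qed
  have "cmod (trace (gauss_sum \<rho> A)) \<le> real CARD('p) ^ 2 * vec.dim (UNIV :: (complex ^ 'd) set)"
  proof (rule cmod_trace_le)
    fix b assume b: "form b b = 1"
    have "(cmod (form (gauss_sum \<rho> A *v b) b))\<^sup>2 \<le> real CARD('p) ^ 4 * Re (form b b)"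
      using Cauchy_Schwarz_unit[OF b] bound order_trans by blast
    also have "\<dots> = (real CARD('p) ^ 2)\<^sup>2"
      using b by (simp flip: power_mult)
    finally show "cmod (form (gauss_sum \<rho> A *v b) b) \<le> real CARD('p) ^ 2"
      by (rule power2_le_imp_le) simp
  qed auto
  then show ?thesis
    by (simp only: vec_dim_card mult.commute)
qed

section \<open>Vectors fixed by the mirabolic subgroup\<close>

definition fixed :: "('p mod_ring ^ 2 ^ 2) set \<Rightarrow> (complex ^ 'd) set" where
  "fixed S = {v. \<forall>X\<in>S. \<rho> X *v v = v}"

lemma subspace_fixed: "vec.subspace (fixed S)"
  by (auto simp: vec.subspace_def fixed_def matrix_vector_right_distrib vec.scale)

text \<open>The stabiliser of the first standard basis vector.\<close>

definition mirabolic :: "('p mod_ring ^ 2 ^ 2) set" where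
  "mirabolic = {X \<in> GL2. X $ 1 $ 1 = 1 \<and> X $ 2 $ 1 = 0}"

lemma mirabolic_subset_GL2: "mirabolic \<subseteq> GL2"
  by (auto simp: mirabolic_def)

definition lower :: "'p mod_ring \<Rightarrow> 'p mod_ring ^ 2 ^ 2" where
  "lower c = mat2 1 0 c 1"

lemma lower_in_GL2 [simp]: "lower c \<in> GL2"
  by (simp add: lower_def in_GL2_iff)

lemma lower_0: "lower 0 = mat 1"
  by (simp add: lower_def mat_1_eq_mat2)

lemma lower_mult: "lower c ** lower d = lower (c + d)"
  by (simp add: lower_def mat2_mult add.commute)

text \<open>The mirabolic and the lower unipotent matrices together generate \<open>GL2\<close>. A
  matrix with nonzero lower left entry is an explicit product of three of them; any other becomes
  such a matrix after multiplication by \<open>lower 1\<close>.\<close>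

lemma fixed_mirabolic_lower:
  assumes w: "w \<in> fixed mirabolic" and low: "\<And>c. \<rho> (lower c) *v w = w"
  shows "w \<in> fixed GL2"
proof -
  have main: "\<rho> X *v w = w" if X: "X \<in> GL2" "X $ 2 $ 1 \<noteq> 0" for X
  proof -
    \<comment> \<open>Adding \<open>b\<close> times the second row of \<open>X\<close> to the first
      gives the row \<open>(1, t)\<close>. Clearing the entry below the 1 then leaves
      \<open>Q\<close>, whose lower right entry is the determinant of \<open>X\<close>.\<close>
    define b where "b = (1 - X $ 1 $ 1) / X $ 2 $ 1"
    define t where "t = X $ 1 $ 2 + b * X $ 2 $ 2"
    define Q where "Q = mat2 1 t 0 (X $ 2 $ 2 - X $ 2 $ 1 * t)"
    define U where "U = mat2 1 (- b) 0 1"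
    have b: "b * X $ 2 $ 1 = 1 - X $ 1 $ 1"
      using X(2) by (simp add: b_def)
    have "X = U ** (lower (X $ 2 $ 1) ** Q)"
      using b by (simp add: U_def Q_def lower_def mat2_mult mat2_eq_iff t_def algebra_simps)
    moreover have "X $ 2 $ 2 - X $ 2 $ 1 * t = X $ 1 $ 1 * X $ 2 $ 2 - X $ 1 $ 2 * X $ 2 $ 1"
    proof -
      have "X $ 2 $ 1 * t = X $ 1 $ 2 * X $ 2 $ 1 + (b * X $ 2 $ 1) * X $ 2 $ 2"
        by (simp add: t_def algebra_simps)
      then show ?thesis
        unfolding b by (simp add: algebra_simps)
    qed
    then have "Q \<in> mirabolic"
      using X(1) by (simp add: Q_def mirabolic_def in_GL2_iff)
    moreover have "U \<in> mirabolic"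
      by (simp add: U_def mirabolic_def in_GL2_iff)
    moreover from calculation have "Q \<in> GL2" "U \<in> GL2" "\<rho> Q *v w = w" "\<rho> U *v w = w"
      using w mirabolic_subset_GL2 by (auto simp: fixed_def)
    moreover have "\<rho> (U ** (lower (X $ 2 $ 1) ** Q)) *v w
        = \<rho> U *v (\<rho> (lower (X $ 2 $ 1)) *v (\<rho> Q *v w))" if "Q \<in> GL2" "U \<in> GL2"
      using that by (simp add: rep_rep_vec GL2_mult)
    ultimately show ?thesis
      using low by simp
  qed
  have "\<rho> X *v w = w" if X: "X \<in> GL2" "X $ 2 $ 1 = 0" for X
  proof -
    \<comment> \<open>An invertible upper triangular matrix has nonzero upper left entry, which
      \<open>lower 1\<close> adds to the lower left corner.\<close>
    have "(lower 1 ** X) $ 2 $ 1 \<noteq> 0"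
      using X by (auto simp: lower_def mat2_mult_nth in_GL2_iff)
    then have "\<rho> (lower 1) *v (\<rho> X *v w) = w"
      using main[of "lower 1 ** X"] X(1) by (simp add: rep_rep_vec GL2_mult)
    then have "\<rho> (lower (- 1)) *v w = \<rho> (lower (- 1)) *v (\<rho> (lower 1) *v (\<rho> X *v w))"
      by simp
    also have "\<dots> = \<rho> X *v w"
      by (subst rep_rep_vec) (simp_all add: lower_mult lower_0)
    finally show ?thesis
      using low by simp
  qed
  then show ?thesis
    using main by (auto simp: fixed_def)
qed

section \<open>Isotypic projections of the lower unipotent group\<close>

definition isotypic_projection :: "'p mod_ring \<Rightarrow> complex ^ 'd ^ 'd" where
  "isotypic_projection j =
     weighted_sum (\<lambda>c. \<rho> (lower c)) UNIV (\<lambda>c. e_p (- (j * c)) / of_nat CARD('p))"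

text \<open>Translating the sum by \<open>c\<close> pulls out the character value: the image of the
  projection is where \<open>lower c\<close> acts by the character
  \<open>e_p (j * c)\<close>.\<close>

lemma lower_isotypic_projection:
  "\<rho> (lower c) *v (isotypic_projection j *v v) = e_p (j * c) *s (isotypic_projection j *v v)"
proof -
  let ?q = "of_nat CARD('p) :: complex"
  have "\<rho> (lower c) *v (isotypic_projection j *v v)
      = (\<Sum>d\<in>UNIV. (e_p (- (j * d)) / ?q) *s (\<rho> (lower (c + d)) *v v))"
    unfolding isotypic_projection_def weighted_sum_mult_vec vec.sum vec.scale
    by (simp add: rep_rep_vec lower_mult)
  also have "\<dots> = (\<Sum>d\<in>UNIV. (e_p (- (j * (d - c))) / ?q) *s (\<rho> (lower d) *v v))"
    by (rule sum.reindex_bij_witness[of _ "\<lambda>d. d - c" "\<lambda>d. c + d"]) auto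
  also have "\<dots> = (\<Sum>d\<in>UNIV. e_p (j * c) *s ((e_p (- (j * d)) / ?q) *s (\<rho> (lower d) *v v)))"
    by (intro sum.cong refl) (simp add: right_diff_distrib e_p_diff e_p_uminus)
  finally show ?thesis
    by (simp add: isotypic_projection_def weighted_sum_mult_vec vec.scale_sum_right)
qed

text \<open>On the image the action of \<open>lower c\<close> cancels its weight, so the average of
  \<open>CARD('p)\<close> equal vectors remains.\<close>

lemma isotypic_projection_idem:
  "isotypic_projection j *v (isotypic_projection j *v v) = isotypic_projection j *v v"
proof -
  let ?F = "isotypic_projection j" and ?q = "of_nat CARD('p) :: complex"
  have "?F *v (?F *v v) = (\<Sum>c\<in>UNIV. (e_p (- (j * c)) / ?q) *s (e_p (j * c) *s (?F *v v)))"
    by (subst isotypic_projection_def) (simp add: weighted_sum_mult_vec lower_isotypic_projection)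
  also have "\<dots> = (\<Sum>c\<in>(UNIV :: 'p mod_ring set). (1 / ?q) *s (?F *v v))"
  proof (intro sum.cong refl)
    fix c
    have "e_p (- (j * c)) * e_p (j * c) = 1"
      by (simp flip: e_p_add)
    then show "(e_p (- (j * c)) / ?q) *s (e_p (j * c) *s (?F *v v)) = (1 / ?q) *s (?F *v v)"
      by simp
  qed
  also have "\<dots> = ?F *v v"
    unfolding vec.scale_sum_left[symmetric] by simp
  finally show ?thesis .
qed

lemma sum_e_p_uminus_div:
  "(\<Sum>j\<in>UNIV. e_p (- (j * c)) / of_nat CARD('p)) = (if c = 0 then 1 else 0)"
  for c :: "'p mod_ring"
  using sum_e_p_mult[of "- c"] by (simp add: mult.commute flip: sum_divide_distrib)

lemma sum_isotypic_projection: "(\<Sum>j\<in>UNIV. isotypic_projection j *v v) = v"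
proof -
  have "(\<Sum>j\<in>UNIV. isotypic_projection j *v v)
      = (\<Sum>c\<in>UNIV. (\<Sum>j\<in>UNIV. e_p (- (j * c)) / of_nat CARD('p)) *s (\<rho> (lower c) *v v))"
    unfolding isotypic_projection_def weighted_sum_mult_vec vec.scale_sum_left by (rule sum.swap)
  also have "\<dots> = (\<Sum>c\<in>(UNIV :: 'p mod_ring set). if c = 0 then v else 0)"
    unfolding sum_e_p_uminus_div by (intro sum.cong refl) (auto simp: lower_0)
  finally show ?thesis
    by simp
qed

text \<open>Summing over \<open>j\<close> kills every \<open>lower c\<close> except the identity. As
  the projections are idempotent, this says that their ranks add up to the dimension.\<close>

lemma sum_trace_isotypic_projection:
  "(\<Sum>j\<in>UNIV. trace (isotypic_projection j)) = of_nat CARD('d)"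
proof -
  have "(\<Sum>j\<in>UNIV. trace (isotypic_projection j))
      = (\<Sum>c\<in>UNIV. (\<Sum>j\<in>UNIV. e_p (- (j * c)) / of_nat CARD('p)) * trace (\<rho> (lower c)))"
    unfolding isotypic_projection_def trace_weighted_sum sum_distrib_right by (rule sum.swap)
  also have "\<dots> = (\<Sum>c\<in>(UNIV :: 'p mod_ring set). if c = 0 then trace (mat 1 :: complex ^ 'd ^ 'd) else 0)"
    unfolding sum_e_p_uminus_div by (intro sum.cong refl) (auto simp: lower_0)
  finally show ?thesis
    by (simp add: trace_I)
qed

text \<open>Conjugation by the diagonal matrix turns \<open>lower c\<close> into
  \<open>lower (a * c)\<close>, while the diagonal matrix itself lies in \<open>mirabolic\<close>
  and fixes \<open>w\<close>.\<close>

lemma torus_isotypic_projection: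
  assumes w: "w \<in> fixed mirabolic" and a: "a \<noteq> 0"
  shows "\<rho> (mat2 1 0 0 a) *v (isotypic_projection j *v w) = isotypic_projection (j / a) *v w"
proof -
  let ?q = "of_nat CARD('p) :: complex" and ?D = "mat2 1 0 0 a"
  have D: "?D \<in> mirabolic" "?D \<in> GL2"
    using a by (simp_all add: mirabolic_def in_GL2_iff)
  have "\<rho> ?D *v (\<rho> (lower c) *v w) = \<rho> (lower (a * c)) *v w" for c
  proof -
    have "\<rho> ?D *v (\<rho> (lower c) *v w) = \<rho> (lower (a * c)) *v (\<rho> ?D *v w)"
      using D(2) by (simp add: rep_rep_vec) (simp add: lower_def mat2_mult)
    then show ?thesis
      using w D(1) by (simp add: fixed_def)
  qed
  then have "\<rho> ?D *v (isotypic_projection j *v w)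
      = (\<Sum>c\<in>UNIV. (e_p (- (j * c)) / ?q) *s (\<rho> (lower (a * c)) *v w))"
    by (simp add: isotypic_projection_def weighted_sum_mult_vec vec.sum vec.scale)
  also have "\<dots> = (\<Sum>c\<in>UNIV. (e_p (- (j / a * c)) / ?q) *s (\<rho> (lower c) *v w))"
    by (rule sum.reindex_bij_witness[of _ "\<lambda>c. c / a" "\<lambda>c. a * c"]) (use a in auto)
  finally show ?thesis
    by (simp add: isotypic_projection_def weighted_sum_mult_vec)
qed

text \<open>The torus carries one nontrivial projection of \<open>w\<close> to all the others. If
  one vanishes, \<open>w\<close> equals its component for the trivial character, hence is fixed by
  the lower unipotent group as well as by \<open>mirabolic\<close>.\<close>

lemma isotypic_projection_kernel:
  assumes w: "w \<in> fixed mirabolic" and j: "j \<noteq> 0" and zero: "isotypic_projection j *v w = 0"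
  shows "w \<in> fixed GL2"
proof -
  have "isotypic_projection k *v w = 0" if "k \<noteq> 0" for k
    \<comment> \<open>The torus element \<open>j / k\<close> is the one that moves index
      \<open>j\<close> to index \<open>k\<close>.\<close>
    using torus_isotypic_projection[OF w, of "j / k" j] j that zero by simp
  then have "(\<Sum>k\<in>UNIV. isotypic_projection k *v w)
      = (\<Sum>k\<in>(UNIV :: 'p mod_ring set). if k = 0 then isotypic_projection 0 *v w else 0)"
    by (intro sum.cong refl) auto
  then have "w = isotypic_projection 0 *v w"
    by (simp add: sum_isotypic_projection)
  then have "\<rho> (lower c) *v w = w" for c
    using lower_isotypic_projection[of c 0 w] by simp
  then show ?thesis
    using w by (rule fixed_mirabolic_lower[rotated])
qed

text \<open>Every nontrivial projection is injective on \<open>fixed mirabolic\<close>, so each of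
  these ranks is at least its dimension, and the ranks of all projections add up to
  \<open>CARD('d)\<close>.\<close>

lemma dim_fixed_mirabolic:
  assumes "fixed GL2 = {0}"
  shows "(real CARD('p) - 1) * vec.dim (fixed mirabolic) \<le> CARD('d)"
proof -
  let ?W = "fixed mirabolic" and ?r = "\<lambda>j. vec.dim (range ((*v) (isotypic_projection j)))"
  have le: "vec.dim ?W \<le> ?r j" if "j \<noteq> 0" for j
  proof -
    have "inj_on ((*v) (isotypic_projection j)) ?W"
    proof (rule inj_onI)
      fix x y assume xy: "x \<in> ?W" "y \<in> ?W" "isotypic_projection j *v x = isotypic_projection j *v y"
      then have "x - y \<in> ?W"
        using subspace_fixed vec.subspace_diff by blast
      moreover have "isotypic_projection j *v (x - y) = 0"
        using xy(3) by (simp add: vec.diff)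
      ultimately show "x = y"
        using isotypic_projection_kernel[OF _ that] assms by force
    qed
    moreover have "vec.span ?W = ?W"
      using subspace_fixed by simp
    ultimately have "inj_on ((*v) (isotypic_projection j)) (vec.span ?W)"
      by (simp only:)
    then have "vec.dim ((*v) (isotypic_projection j) ` ?W) = vec.dim ?W"
      by (rule vec.dim_image_eq[OF matrix_vector_mul_linear_gen])
    then show ?thesis
      by (metis image_mono subset_UNIV vec.dim_subset)
  qed
  have "complex_of_real (real (\<Sum>j\<in>UNIV. ?r j)) = of_nat CARD('d)"
    using sum_trace_isotypic_projection
    by (simp add: trace_idempotent_eq_dim_range[OF isotypic_projection_idem])
  then have total: "(\<Sum>j\<in>UNIV. ?r j) = CARD('d)"
    by (metis of_nat_eq_iff of_real_of_nat_eq)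
  have "(real CARD('p) - 1) * vec.dim ?W = (\<Sum>j\<in>-{0::'p mod_ring}. real (vec.dim ?W))"
    by (simp add: card_mod_ring_nonzero)
  also have "\<dots> \<le> (\<Sum>j\<in>-{0}. real (?r j))"
    using le by (intro sum_mono) auto
  also have "\<dots> \<le> (\<Sum>j\<in>UNIV. real (?r j))"
    by (rule sum_mono2) auto
  finally show ?thesis
    using total by (simp flip: of_nat_sum)
qed

end

section \<open>Gauss sums of rank one matrices\<close>

context GL2_representation
begin

lemma trace_rep_conjugate:
  assumes "P \<in> GL2" "P' \<in> GL2" "P' ** P = mat 1" "X \<in> GL2"
  shows "trace (\<rho> (P ** X ** P')) = trace (\<rho> X)"
proof -
  have "trace (\<rho> (P ** X ** P')) = trace ((\<rho> P ** \<rho> X) ** \<rho> P')"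
    using assms by (simp add: rep_mult GL2_mult)
  also have "\<dots> = trace (\<rho> P' ** (\<rho> P ** \<rho> X))"
    by (rule trace_mul_sym)
  also have "\<dots> = trace (\<rho> (P' ** (P ** X)))"
    using assms by (simp add: rep_mult GL2_mult)
  finally show ?thesis
    using assms(3) by (simp add: matrix_mul_assoc)
qed

text \<open>Substitute \<open>P ** X ** P'\<close> for \<open>X\<close>: both the trace pairing and
  the character of \<open>\<rho>\<close> are invariant under conjugation.\<close>

lemma trace_gauss_sum_conjugate:
  assumes "P \<in> GL2" "P' \<in> GL2" "P' ** P = mat 1"
  shows "trace (gauss_sum \<rho> (P ** A ** P')) = trace (gauss_sum \<rho> A)"
proof -
  have bij: "bij_betw (\<lambda>X. P ** X ** P') GL2 GL2"
    using bij_betw_trans[OF bij_betw_GL2_mult_left[OF assms(1)] bij_betw_GL2_mult_right[OF assms(2)]]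
    by (simp add: o_def)
  have arg: "trace (P ** A ** P' ** (P ** X ** P')) = trace (A ** X)" for X
  proof -
    have "P ** A ** P' ** (P ** X ** P') = P ** A ** (P' ** P) ** (X ** P')"
      by (simp only: matrix_mul_assoc)
    then have "trace (P ** A ** P' ** (P ** X ** P')) = trace ((P ** (A ** X)) ** P')"
      using assms(3) by (simp add: matrix_mul_assoc)
    also have "\<dots> = trace (P' ** (P ** (A ** X)))"
      by (rule trace_mul_sym)
    finally show ?thesis
      using assms(3) by (simp add: matrix_mul_assoc)
  qed
  have "trace (gauss_sum \<rho> (P ** A ** P'))
      = (\<Sum>X\<in>GL2. e_p (trace (P ** A ** P' ** (P ** X ** P'))) * trace (\<rho> (P ** X ** P')))"
    unfolding gauss_sum_eq_weighted_sum trace_weighted_sum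
    by (rule sum.reindex_bij_betw[OF bij, symmetric])
  also have "\<dots> = (\<Sum>X\<in>GL2. e_p (trace (A ** X)) * trace (\<rho> X))"
    unfolding arg using assms by (intro sum.cong refl) (simp add: trace_rep_conjugate)
  finally show ?thesis
    unfolding gauss_sum_eq_weighted_sum trace_weighted_sum .
qed

section \<open>Averaging down to the Borel subgroup\<close>

lemma trace_mat2_row_mult: "trace (mat2 \<alpha> \<beta> 0 0 ** X) = \<alpha> * X $ 1 $ 1 + \<beta> * X $ 2 $ 1"
  for X :: "'p mod_ring ^ 2 ^ 2"
  by (simp add: trace_def sum_2 mat2_mult_nth)

definition borel_sum :: "'p mod_ring \<Rightarrow> complex ^ 'd ^ 'd" where
  "borel_sum \<alpha> = weighted_sum \<rho> borel_GL2 (\<lambda>X. e_p (\<alpha> * X $ 1 $ 1))"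

text \<open>The sum of \<open>e_p (\<beta> * X $ 2 $ 1)\<close> over \<open>\<beta>\<close> vanishes
  unless the lower left entry of \<open>X\<close> is zero.\<close>

lemma trace_borel_sum:
  "of_nat CARD('p) * trace (borel_sum \<alpha>) = (\<Sum>\<beta>\<in>UNIV. trace (gauss_sum \<rho> (mat2 \<alpha> \<beta> 0 0)))"
proof -
  have "(\<Sum>\<beta>\<in>UNIV. trace (gauss_sum \<rho> (mat2 \<alpha> \<beta> 0 0)))
      = (\<Sum>X\<in>GL2. \<Sum>\<beta>\<in>UNIV. e_p (\<alpha> * X $ 1 $ 1 + \<beta> * X $ 2 $ 1) * trace (\<rho> X))"
    unfolding gauss_sum_eq_weighted_sum trace_weighted_sum trace_mat2_row_mult by (rule sum.swap)
  also have "\<dots> = (\<Sum>X\<in>GL2. e_p (\<alpha> * X $ 1 $ 1) * trace (\<rho> X) * (\<Sum>\<beta>\<in>UNIV. e_p (X $ 2 $ 1 * \<beta>)))"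
    by (simp add: e_p_add sum_distrib_left ac_simps)
  also have "\<dots> = (\<Sum>X\<in>borel_GL2. of_nat CARD('p) * (e_p (\<alpha> * X $ 1 $ 1) * trace (\<rho> X)))"
    unfolding sum_e_p_mult by (rule sum.mono_neutral_cong_right) (auto simp: borel_GL2_def)
  finally show ?thesis
    unfolding borel_sum_def trace_weighted_sum by (simp add: sum_distrib_left)
qed

text \<open>Matrices with the same nonzero \<open>\<alpha>\<close> are conjugate for all
  \<open>\<beta>\<close>, so the average over \<open>\<beta>\<close> is the average of a
  constant.\<close>

lemma trace_gauss_sum_row_nonnilpotent:
  assumes "\<alpha> \<noteq> 0"
  shows "trace (gauss_sum \<rho> (mat2 \<alpha> \<beta> 0 0)) = trace (borel_sum \<alpha>)"
proof -
  have "trace (gauss_sum \<rho> (mat2 \<alpha> \<beta>' 0 0)) = trace (gauss_sum \<rho> (mat2 \<alpha> \<beta> 0 0))" for \<beta>'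
  proof -
    \<comment> \<open>Chosen so that the second column operation turns \<open>\<beta>\<close> into
      \<open>\<beta> + \<alpha> * ?c\<close>, which is \<open>\<beta>'\<close>.\<close>
    let ?c = "(\<beta>' - \<beta>) / \<alpha>"
    have "mat2 1 (- ?c) 0 1 ** mat2 \<alpha> \<beta> 0 0 ** mat2 1 ?c 0 1 = mat2 \<alpha> \<beta>' 0 0"
      using assms by (simp add: mat2_mult)
    then show ?thesis
      using trace_gauss_sum_conjugate[of "mat2 1 (- ?c) 0 1" "mat2 1 ?c 0 1" "mat2 \<alpha> \<beta> 0 0"]
      by (simp add: in_GL2_iff mat2_mult mat_1_eq_mat2)
  qed
  then have "of_nat CARD('p) * trace (borel_sum \<alpha>)
      = (\<Sum>\<beta>'\<in>(UNIV :: 'p mod_ring set). trace (gauss_sum \<rho> (mat2 \<alpha> \<beta> 0 0)))"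
    unfolding trace_borel_sum by (intro sum.cong refl)
  then show ?thesis
    by simp
qed

text \<open>Here only the nonzero values of \<open>\<beta>\<close> are conjugate, through diagonal
  matrices; the value 0 contributes the Gauss sum of the zero matrix separately.\<close>

lemma trace_gauss_sum_row_nilpotent:
  assumes "\<beta> \<noteq> 0"
  shows "of_nat CARD('p) * trace (borel_sum 0)
    = trace (gauss_sum \<rho> 0) + (of_nat CARD('p) - 1) * trace (gauss_sum \<rho> (mat2 0 \<beta> 0 0))"
proof -
  have conj: "trace (gauss_sum \<rho> (mat2 0 \<beta>' 0 0)) = trace (gauss_sum \<rho> (mat2 0 \<beta> 0 0))" if "\<beta>' \<noteq> 0" for \<beta>'
  proof -
    let ?a = "\<beta>' / \<beta>"
    have "mat2 ?a 0 0 1 ** mat2 0 \<beta> 0 0 ** mat2 (inverse ?a) 0 0 1 = mat2 0 \<beta>' 0 0"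
      using assms by (simp add: mat2_mult)
    then show ?thesis
      using trace_gauss_sum_conjugate[of "mat2 ?a 0 0 1" "mat2 (inverse ?a) 0 0 1" "mat2 0 \<beta> 0 0"] assms that
      by (simp add: in_GL2_iff mat2_mult mat_1_eq_mat2)
  qed
  have zero: "mat2 0 0 0 0 = (0 :: 'p mod_ring ^ 2 ^ 2)"
    by (simp add: mat2_eq_iff)
  have "of_nat CARD('p) * trace (borel_sum 0)
      = trace (gauss_sum \<rho> 0) + (\<Sum>\<beta>'\<in>UNIV - {0}. trace (gauss_sum \<rho> (mat2 0 \<beta>' 0 0)))"
    unfolding trace_borel_sum by (subst sum.remove[of _ 0]) (simp_all add: zero)
  also have "(\<Sum>\<beta>'\<in>UNIV - {0}. trace (gauss_sum \<rho> (mat2 0 \<beta>' 0 0)))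
      = (\<Sum>\<beta>'\<in>UNIV - {0 :: 'p mod_ring}. trace (gauss_sum \<rho> (mat2 0 \<beta> 0 0)))"
    using conj by (intro sum.cong refl) auto
  also have "\<dots> = (of_nat CARD('p) - 1) * trace (gauss_sum \<rho> (mat2 0 \<beta> 0 0))"
    by (simp add: card_Diff_singleton of_nat_diff Suc_leI)
  finally show ?thesis .
qed

text \<open>Left multiplication by a mirabolic matrix permutes the Borel subgroup and preserves the
  upper left entry, on which the weight depends.\<close>

lemma borel_sum_in_fixed_mirabolic: "borel_sum \<alpha> *v v \<in> fixed mirabolic"
proof -
  have "\<rho> Y *v (borel_sum \<alpha> *v v) = borel_sum \<alpha> *v v" if Y: "Y \<in> mirabolic" for Y
  proof -
    have Y': "Y \<in> GL2" "Y $ 1 $ 1 = 1" "Y $ 2 $ 1 = 0"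
      using Y by (auto simp: mirabolic_def)
    obtain Z where Z: "Z \<in> GL2" "Y ** Z = mat 1" "Z ** Y = mat 1"
      using GL2_inverse[OF Y'(1)] .
    have "(Z ** Y) $ 2 $ 1 = 0" "(Z ** Y) $ 1 $ 1 = 1"
      by (simp_all add: Z(3) mat_def)
    then have Z': "Z $ 2 $ 1 = 0" "Z $ 1 $ 1 = 1"
      using Y' by (simp_all add: mat2_mult_nth)
    have "\<rho> Y *v (borel_sum \<alpha> *v v) = (\<Sum>X\<in>borel_GL2. e_p (\<alpha> * X $ 1 $ 1) *s (\<rho> (Y ** X) *v v))"
      unfolding borel_sum_def weighted_sum_mult_vec vec.sum vec.scale
      using Y'(1) by (intro sum.cong refl) (simp add: rep_rep_vec borel_GL2_def)
    also have "\<dots> = (\<Sum>X\<in>borel_GL2. e_p (\<alpha> * X $ 1 $ 1) *s (\<rho> X *v v))"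
      by (rule sum.reindex_bij_witness[of _ "\<lambda>X. Z ** X" "\<lambda>X. Y ** X"])
        (use Y' Z Z' in \<open>auto simp: borel_GL2_def mat2_mult_nth matrix_mul_assoc\<close>)
    finally show ?thesis
      by (simp add: borel_sum_def weighted_sum_mult_vec)
  qed
  then show ?thesis
    by (simp add: fixed_def)
qed

text \<open>The range lies in \<open>fixed mirabolic\<close>, and one of the two factors
  \<open>CARD('p) - 1\<close> in the order of the Borel subgroup is absorbed by
  \<open>dim_fixed_mirabolic\<close>.\<close>

lemma cmod_trace_borel_sum:
  assumes "fixed GL2 = {0}"
  shows "cmod (trace (borel_sum \<alpha>)) \<le> real CARD('p) * (real CARD('p) - 1) * CARD('d)"
proof -
  let ?p = "real CARD('p)" and ?r = "real (vec.dim (fixed mirabolic))"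
  have p: "?p \<ge> 1"
    by (simp add: Suc_leI)
  have "cmod (trace (borel_sum \<alpha>)) \<le> real (card (borel_GL2 :: ('p mod_ring ^ 2 ^ 2) set)) * ?r"
    unfolding borel_sum_def
    by (rule cmod_trace_weighted_sum_le)
      (auto simp: borel_GL2_def subspace_fixed borel_sum_in_fixed_mirabolic[unfolded borel_sum_def borel_GL2_def])
  also have "\<dots> = ?p * (?p - 1) * ((?p - 1) * ?r)"
    by (simp add: card_borel power2_eq_square)
  also have "\<dots> \<le> ?p * (?p - 1) * CARD('d)"
    using p by (intro mult_left_mono dim_fixed_mirabolic[OF assms]) simp
  finally show ?thesis .
qed

text \<open>The zero matrix is unchanged by multiplication, so the image of its Gauss sum consists
  of vectors fixed by the whole group.\<close>

lemma gauss_sum_0: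
  assumes "fixed GL2 = {0}"
  shows "gauss_sum \<rho> 0 = 0"
proof -
  have "gauss_sum \<rho> 0 *v v \<in> fixed GL2" for v
    unfolding fixed_def
  proof (intro CollectI ballI)
    fix B :: "'p mod_ring ^ 2 ^ 2" assume "B \<in> GL2"
    then obtain C where "C \<in> GL2" "B ** C = mat 1" "C ** B = mat 1"
      by (rule GL2_inverse)
    then show "\<rho> B *v (gauss_sum \<rho> 0 *v v) = gauss_sum \<rho> 0 *v v"
      using \<open>B \<in> GL2\<close> rep_gauss_sum[of B C 0 v] by simp
  qed
  then show ?thesis
    using assms by (simp add: matrix_eq)
qed

lemma cmod_trace_gauss_sum_row:
  assumes "fixed GL2 = {0}" "\<alpha> \<noteq> 0 \<or> \<beta> \<noteq> 0"
  shows "cmod (trace (gauss_sum \<rho> (mat2 \<alpha> \<beta> 0 0))) \<le> real CARD('d) * real CARD('p) ^ 2"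
proof -
  let ?p = "real CARD('p)"
  have p: "?p > 1"
    using prime_gt_1_nat[OF prime_card[where 'a = 'p]] by simp
  show ?thesis
  proof (cases "\<alpha> = 0")
    case False
    then have "cmod (trace (gauss_sum \<rho> (mat2 \<alpha> \<beta> 0 0))) \<le> ?p * (?p - 1) * CARD('d)"
      using cmod_trace_borel_sum[OF assms(1)] by (simp add: trace_gauss_sum_row_nonnilpotent)
    also have "\<dots> \<le> ?p * ?p * CARD('d)"
      using p by (intro mult_right_mono mult_left_mono) auto
    finally show ?thesis
      by (simp add: power2_eq_square mult.commute)
  next
    case True
    have "trace (gauss_sum \<rho> 0) = 0"
      using gauss_sum_0[OF assms(1)] by (simp add: trace_def)
    then have "complex_of_real (?p - 1) * trace (gauss_sum \<rho> (mat2 0 \<beta> 0 0)) = of_real ?p * trace (borel_sum 0)"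
      using trace_gauss_sum_row_nilpotent[of \<beta>] assms(2) True by simp
    then have "cmod (complex_of_real (?p - 1)) * cmod (trace (gauss_sum \<rho> (mat2 0 \<beta> 0 0)))
        = cmod (complex_of_real ?p) * cmod (trace (borel_sum 0))"
      by (metis norm_mult)
    then have "(?p - 1) * cmod (trace (gauss_sum \<rho> (mat2 0 \<beta> 0 0))) = ?p * cmod (trace (borel_sum 0))"
      using p by (simp only: norm_of_real)
    also have "\<dots> \<le> ?p * (?p * (?p - 1) * CARD('d))"
      by (intro mult_left_mono cmod_trace_borel_sum[OF assms(1)]) simp
    \<comment> \<open>The factor \<open>?p - 1\<close> from the Borel bound matches the number of
      nonzero \<open>\<beta>\<close> and cancels, leaving exactly the claimed bound.\<close>
    also have "\<dots> = (?p - 1) * (real CARD('d) * ?p ^ 2)"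
      by (simp add: power2_eq_square)
    finally show ?thesis
      using p True by simp
  qed
qed

text \<open>With trivial action the rank bound fails, and the trace is computed instead: the
  oscillation comes from the sum of \<open>e_p (\<alpha> * a)\<close> over nonzero \<open>a\<close>,
  which is -1.\<close>

lemma cmod_trace_gauss_sum_row_trivial:
  assumes triv: "fixed GL2 = UNIV" and nz: "\<alpha> \<noteq> 0 \<or> \<beta> \<noteq> 0"
  shows "cmod (trace (gauss_sum \<rho> (mat2 \<alpha> \<beta> 0 0))) \<le> real CARD('d) * real CARD('p) ^ 2"
proof -
  let ?p = "real CARD('p)"
  have p: "?p > 1"
    using prime_gt_1_nat[OF prime_card[where 'a = 'p]] by simp
  have rep: "\<rho> X = mat 1" if "X \<in> GL2" for X
    using triv that by (auto simp: matrix_eq fixed_def)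
  have main: "cmod (trace (gauss_sum \<rho> (mat2 \<alpha> \<beta> 0 0))) \<le> real CARD('d) * ?p ^ 2" if \<alpha>: "\<alpha> \<noteq> 0" for \<alpha> \<beta>
  proof -
    have "(\<Sum>a\<in>UNIV. e_p (\<alpha> * a)) = 1 + (\<Sum>a\<in>-{0}. e_p (\<alpha> * a))"
      by (subst sum.remove[of _ 0]) (simp_all add: Compl_eq_Diff_UNIV)
    then have e: "(\<Sum>a\<in>-{0}. e_p (\<alpha> * a)) = - 1"
      using sum_e_p_mult[of \<alpha>] \<alpha> by (simp add: eq_neg_iff_add_eq_0 add.commute)
    have "trace (gauss_sum \<rho> (mat2 \<alpha> \<beta> 0 0)) = (\<Sum>X\<in>borel_GL2. e_p (\<alpha> * X $ 1 $ 1) * of_nat CARD('d))"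
      unfolding trace_gauss_sum_row_nonnilpotent[OF \<alpha>] borel_sum_def trace_weighted_sum
      by (intro sum.cong refl) (simp add: borel_GL2_def rep trace_I)
    also have "\<dots> = of_nat (CARD('p) * card (-{0 :: 'p mod_ring}) * CARD('d)) * (\<Sum>a\<in>-{0}. e_p (\<alpha> * a))"
      unfolding sum_borel by (simp add: sum_distrib_left ac_simps)
    also have "\<dots> = - of_real (?p * real (card (-{0 :: 'p mod_ring})) * CARD('d))"
      unfolding e by simp
    finally have "cmod (trace (gauss_sum \<rho> (mat2 \<alpha> \<beta> 0 0))) = \<bar>?p * (?p - 1) * CARD('d)\<bar>"
      by (simp only: norm_minus_cancel norm_of_real card_mod_ring_nonzero)
    also have "\<dots> = ?p * (?p - 1) * CARD('d)"
      using p by simp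
    also have "\<dots> \<le> ?p * ?p * CARD('d)"
      using p by (intro mult_right_mono mult_left_mono) auto
    finally show ?thesis
      by (simp add: power2_eq_square mult.commute)
  qed
  show ?thesis
  proof (cases "\<alpha> = 0")
    case True
    \<comment> \<open>Since \<open>\<rho>\<close> is trivial, one-sided multiplication by the swap
      matrix also preserves the trace; it moves \<open>\<beta>\<close> to the diagonal and reduces
      to the case already treated.\<close>
    let ?w = "mat2 0 1 1 0 :: 'p mod_ring ^ 2 ^ 2"
    have w: "?w \<in> GL2"
      by (simp add: in_GL2_iff)
    have mult: "mat2 0 \<beta> 0 0 ** ?w = mat2 \<beta> 0 0 0"
      by (simp add: mat2_mult)
    have "trace (gauss_sum \<rho> A) = (\<Sum>X\<in>GL2. e_p (trace (A ** X)) * of_nat CARD('d))" for A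
      unfolding gauss_sum_eq_weighted_sum trace_weighted_sum
      by (intro sum.cong refl) (simp add: rep trace_I)
    moreover have "(\<Sum>X\<in>GL2. e_p (trace (mat2 0 \<beta> 0 0 ** X)) * of_nat CARD('d))
        = (\<Sum>X\<in>GL2. e_p (trace (mat2 0 \<beta> 0 0 ** (?w ** X))) * of_nat CARD('d) :: complex)"
      by (rule sum.reindex_bij_betw[OF bij_betw_GL2_mult_left[OF w], symmetric])
    ultimately have "trace (gauss_sum \<rho> (mat2 0 \<beta> 0 0)) = trace (gauss_sum \<rho> (mat2 \<beta> 0 0 0))"
      by (simp add: matrix_mul_assoc mult)
    then show ?thesis
      using main[of \<beta> 0] nz True by simp
  qed (rule main)
qed

end

text \<open>The rows of a singular matrix are dependent: either the second row is zero already, or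
  the first is \<open>t\<close> times the second and a row operation with a swap clears it.\<close>

lemma singular_conjugate_row:
  fixes A :: "'p::prime_card mod_ring ^ 2 ^ 2"
  assumes "A \<noteq> 0" "A \<notin> GL2"
  obtains P P' \<alpha> \<beta> where "P \<in> GL2" "P' \<in> GL2" "P' ** P = mat 1" "P ** A ** P' = mat2 \<alpha> \<beta> 0 0"
    "\<alpha> \<noteq> 0 \<or> \<beta> \<noteq> 0"
proof (cases "A $ 2 $ 1 = 0 \<and> A $ 2 $ 2 = 0")
  case True
  then have "A = mat2 (A $ 1 $ 1) (A $ 1 $ 2) 0 0"
    by (simp add: mat2_eq_iff)
  moreover have "A $ 1 $ 1 \<noteq> 0 \<or> A $ 1 $ 2 \<noteq> 0"
    using assms(1) True by (auto simp: mat2_eq_iff)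
  ultimately show ?thesis
    by (intro that[of "mat 1" "mat 1" "A $ 1 $ 1" "A $ 1 $ 2"]) auto
next
  case False
  \<comment> \<open>The ratio is read off at a nonzero entry of the second row.\<close>
  define t where "t = (if A $ 2 $ 1 = 0 then A $ 1 $ 2 / A $ 2 $ 2 else A $ 1 $ 1 / A $ 2 $ 1)"
  have det: "A $ 1 $ 1 * A $ 2 $ 2 = A $ 1 $ 2 * A $ 2 $ 1"
    using assms(2) by (simp add: in_GL2_iff)
  have t: "A $ 1 $ 1 = t * A $ 2 $ 1" "A $ 1 $ 2 = t * A $ 2 $ 2"
    using det False by (auto simp: t_def field_simps)
  define c d where "c = A $ 2 $ 1" and "d = A $ 2 $ 2"
  have A: "A = mat2 (t * c) (t * d) c d"
    using t by (simp add: mat2_eq_iff c_def d_def)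
  \<comment> \<open>The left factor moves the second row up and puts the first row minus
    \<open>t\<close> times the second, which is zero, below it; the right factor is its
    inverse.\<close>
  have "mat2 0 1 1 (- t) ** A ** mat2 t 1 1 0 = mat2 (c * t + d) c 0 0"
    unfolding A by (simp add: mat2_mult algebra_simps)
  moreover have "c * t + d \<noteq> 0 \<or> c \<noteq> 0"
    using False by (auto simp: c_def d_def)
  ultimately show ?thesis
    by (intro that[of "mat2 0 1 1 (- t)" "mat2 t 1 1 0" "c * t + d" c])
      (auto simp: in_GL2_iff mat2_mult mat_1_eq_mat2)
qed

theorem theorem1p10:
  fixes \<rho> :: "'p::prime_card mod_ring ^ 2 ^ 2 \<Rightarrow> complex ^ 'd ^ 'd"
    and A :: "'p mod_ring ^ 2 ^ 2"
  assumes "CARD('p) > 2"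
    and "is_irreducible_representation \<rho>"
    and "A \<noteq> 0"
  shows "cmod (trace (gauss_sum \<rho> A)) \<le> real CARD('d) * real CARD('p) ^ 2"
proof -
  interpret GL2_representation \<rho>
    using assms(2) by unfold_locales (simp add: is_irreducible_representation_def)
  show ?thesis
  proof (cases "A \<in> GL2")
    case True
    then show ?thesis
      by (rule cmod_trace_gauss_sum_invertible)
  next
    case False
    obtain P P' \<alpha> \<beta> where P: "P \<in> GL2" "P' \<in> GL2" "P' ** P = mat 1"
      and row: "P ** A ** P' = mat2 \<alpha> \<beta> 0 0" and nz: "\<alpha> \<noteq> 0 \<or> \<beta> \<noteq> 0"
      using singular_conjugate_row[OF assms(3) False] .
    have "\<rho> X *v w \<in> fixed GL2" if "X \<in> GL2" "w \<in> fixed GL2" for X w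
      using that by (simp add: fixed_def)
    \<comment> \<open>Irreducibility enters by applying it to the invariant subspace
      \<open>fixed GL2\<close>: either there is no nonzero fixed vector, or the action is
      trivial.\<close>
    then have "fixed GL2 = {0} \<or> fixed GL2 = UNIV"
      using assms(2) subspace_fixed by (simp add: is_irreducible_representation_def)
    then have "cmod (trace (gauss_sum \<rho> (mat2 \<alpha> \<beta> 0 0))) \<le> real CARD('d) * real CARD('p) ^ 2"
      using cmod_trace_gauss_sum_row cmod_trace_gauss_sum_row_trivial nz by blast
    then show ?thesis
      using trace_gauss_sum_conjugate[OF P, of A] row by simp
  qed
qed

end
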